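(* Consider the DC microgrid model of the context. Let $\tilde{\mathcal E}_c$ be a set of communication links on which ZTS attacks with constant fake unknown inputs $\bar{\boldsymbol d}^a_{ij}\in\mathbb R^2$, $(i,j)\in\tilde{\mathcal E}_c$, are launched simultaneously at time $T_a$, cooperatively in the sense that $$\sum_{(i,j)\in\tilde{\mathcal E}_c}\frac{k_Ia^c_{ij}}{I^s_{tj}}\,\boldsymbol k^{\rm T}A_{kj}^{-1}\bar E_j\bar{\boldsymbol d}^a_{ij}=0,\qquad \boldsymbol k^{\rm T}=[0,1,0].$$ Then $$\langle\boldsymbol\psi_a(\infty)\rangle=-\sum_{(i,j)\in\tilde{\mathcal E}_c}\frac{k_Ia^c_{ij}}{N I^s_{tj}}\,\boldsymbol k^{\rm T}A_{kj}^{-2}\bar E_j\bar{\boldsymbol d}^a_{ij}.$$ Under these attacks, voltage balancing is not achieved if $\sum_{(i,j)\in\tilde{\mathcal E}_c}\frac{k_Ia^c_{ij}}{I^s_{tj}}\boldsymbol k^{\rm T}A_{kj}^{-2}\bar E_j\bar{\boldsymbol d}^a_{ij}\ne0$, and current sharing is not achieved if $\sum_{(i,j)\in\tilde{\mathcal E}_c}\frac{k_Ia^c_{ij}}{I^s_{tj}}\boldsymbol k^{\rm T}A_{kj}^{-1}\bar E_j\bar{\boldsymbol d}^a_{ij}\,\boldsymbol l_i\neq\mathbf 0\in\mathbb R^N$, where $\boldsymbol l_i\in\mathbb R^N$ is the $i$-th standard basis vector.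
   Context: Notation: $\langle\boldsymbol v\rangle$ is the average of the entries of $\boldsymbol v\in\mathbb R^N$; $y(\infty)=\lim_{t\to\infty}y(t)$. Network: $N$ DGUs with node set $\mathcal V=\{1,\dots,N\}$. The electrical network and the communication network are connected weighted undirected graphs with the same topology and the same positive edge weights $a^c_{ij}=a^c_{ji}$ (line conductances), so their Laplacians coincide, $L=M$. $\mathcal N_i^c$ is the set of neighbours of $i$. All nominal reference voltages equal $V_{ref}$. Rated currents $I^s_{ti}>0$, gain $k_I>0$, constant load currents $\boldsymbol i_l\in\mathbb R^N$. Dynamics: with PCC voltages $\boldsymbol v(t)=[V_1,\dots,V_N]^{\rm T}$, output currents $\boldsymbol i_t(t)=[I_{t1},\dots,I_{tN}]^{\rm T}$ and secondary control inputs $\boldsymbol\psi(t)=[\psi_1,\dots,\psi_N]^{\rm T}$, the primary loops are simplified to unit gains, $\boldsymbol v(t)=V_{ref}\mathbb 1+\boldsymbol\psi(t)$; Kirchhoff's current law gives $\boldsymbol i_t(t)=M\boldsymbol v(t)+\boldsymbol i_l$; and $$\dot\psi_i(t)=-k_I\sum_{j\in\mathcal N_i^c}a^c_{ij}\Big(\frac{I_{ti}(t)}{I^s_{ti}}-\frac{I^c_{i,j}(t)}{I^s_{tj}}\Big),$$ where $I^c_{i,j}$ is the current of DGU $j$ as received by DGU $i$. Without attack on $(i,j)$, $I^c_{i,j}=I_{tj}$. Without any attack voltage balancing is achieved; accordingly $\langle\boldsymbol\psi(0)\rangle=0$. Attack: an attack on link $(i,j)$ (data sent by $j$ to $i$)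 starting at $T_a$ with vector $\boldsymbol\phi_{i,j}(t)\in\mathbb R^3$ replaces $I^c_{i,j}(t)$ by $I_{tj}(t)+\boldsymbol k^{\rm T}\boldsymbol\phi_{i,j}(t)$ for $t\ge T_a$, $\boldsymbol k^{\rm T}=[0,1,0]$. A ZTS attack with constant fake unknown input $\bar{\boldsymbol d}^a_{ij}\in\mathbb R^2$ is given by $\dot{\boldsymbol\phi}_{i,j}=A_{kj}\boldsymbol\phi_{i,j}+\bar E_j\bar{\boldsymbol d}^a_{ij}$ for $t\ge T_a$, $\boldsymbol\phi_{i,j}(T_a)=\mathbf 0$, with $\bar E_j\bar{\boldsymbol d}^a_{ij}\ne\mathbf 0$. Here $A_{kj}\in\mathbb R^{3\times3}$ is the Hurwitz closed-loop matrix of DGU $j$ and $\bar E_j=\begin{bmatrix}1/C_{tj}&0\\0&0\\0&1\end{bmatrix}$, $C_{tj}>0$. $\boldsymbol\psi_a$: write $\boldsymbol\psi=\tilde{\boldsymbol\psi}+\boldsymbol\psi_a$, where $\tilde{\boldsymbol\psi}$ is the solution of the attack-free dynamics with the same initial condition, and $\boldsymbol\psi_a$ (zero up to $T_a$) is the malicious component due to the attacks. $\langle\boldsymbol\psi_a(\infty)\rangle$ denotes $\lim_{t\to\infty}\langle\boldsymbol\psi_a(t)\rangle$. Voltage balancing is achieved if $\langle\boldsymbol v(\infty)\rangle=V_{ref}$. Current sharing is achieved if $I_{ti}(\infty)/I^s_{ti}=I_{tj}(\infty)/I^s_{tj}$ for all $i,j\in\mathcal V$. *)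

theory Defs
  imports "HOL-Analysis.Analysis"
begin

definition avg :: "real ^ 'n \<Rightarrow> real" where
  "avg x = (\<Sum>i\<in>UNIV. x $ i) / real CARD('n)"

text \<open>Networks: the finite type \<open>'n\<close> is the set of DGUs, \<open>E\<close> the set of links, stored as a
  symmetric relation, and \<open>a\<close> the edge weights, relevant only on \<open>E\<close>.\<close>

definition connected_weighted_graph :: "('n \<times> 'n) set \<Rightarrow> ('n \<Rightarrow> 'n \<Rightarrow> real) \<Rightarrow> bool" where
  "connected_weighted_graph E a \<longleftrightarrow>
     sym E \<and> irrefl E \<and> (\<forall>(i, j) \<in> E. a i j = a j i \<and> a i j > 0) \<and> (\<forall>i j. (i, j) \<in> E\<^sup>*)"

definition neighbours :: "('n \<times> 'n) set \<Rightarrow> 'n \<Rightarrow> 'n set" where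
  "neighbours E i = {j. (i, j) \<in> E}"

definition laplacian :: "('n::finite \<times> 'n) set \<Rightarrow> ('n \<Rightarrow> 'n \<Rightarrow> real) \<Rightarrow> real ^ 'n ^ 'n" where
  "laplacian E a = (\<chi> i j. if i = j then (\<Sum>k\<in>neighbours E i. a i k)
                           else if (i, j) \<in> E then - a i j else 0)"

text \<open>Eigenvalues are complex, so the real matrix is mapped into the complex ones first.\<close>

definition hurwitz :: "real ^ 'm ^ 'm \<Rightarrow> bool" where
  "hurwitz A \<longleftrightarrow>
     (\<forall>(\<mu>::complex) (x::complex ^ 'm).
        x \<noteq> 0 \<and> (\<chi> i j. complex_of_real (A $ i $ j)) *v x = \<mu> *s x \<longrightarrow> Re \<mu> < 0)"

definition k_vec :: "real ^ 3" where
  "k_vec = vector [0, 1, 0]"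

definition E_bar :: "real \<Rightarrow> real ^ 2 ^ 3" where
  "E_bar C = vector [vector [1 / C, 0], vector [0, 0], vector [0, 1]]"

text \<open>The single graph \<open>(E, a)\<close> is both the electrical network (through its Laplacian) and the
  communication network (through the control law). \<open>Ic t i j\<close> is the current of DGU \<open>j\<close> as
  received by DGU \<open>i\<close> at time \<open>t\<close>. Time starts at \<open>0\<close>.\<close>

definition microgrid_trajectory ::
  "('n::finite \<times> 'n) set \<Rightarrow> ('n \<Rightarrow> 'n \<Rightarrow> real) \<Rightarrow> real \<Rightarrow> real \<Rightarrow> real ^ 'n \<Rightarrow> real ^ 'n
   \<Rightarrow> (real \<Rightarrow> 'n \<Rightarrow> 'n \<Rightarrow> real)
   \<Rightarrow> (real \<Rightarrow> real ^ 'n) \<Rightarrow> (real \<Rightarrow> real ^ 'n) \<Rightarrow> (real \<Rightarrow> real ^ 'n) \<Rightarrow> bool" where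
  "microgrid_trajectory E a Vref kI Is il Ic v it \<psi> \<longleftrightarrow>
     (\<forall>t\<ge>0. v t = (\<chi> i. Vref) + \<psi> t \<and>
            it t = laplacian E a *v v t + il \<and>
            (\<forall>i. ((\<lambda>s. \<psi> s $ i) has_real_derivative
                    - kI * (\<Sum>j\<in>neighbours E i. a i j * (it t $ i / Is $ i - Ic t i j / Is $ j)))
                  (at t within {0..})))"

text \<open>The pair \<open>(i, j)\<close> in \<open>Ea\<close> stands for the data sent by \<open>j\<close> to \<open>i\<close>, so \<open>Ea\<close> need not be
  symmetric.\<close>

definition received_current ::
  "('n \<times> 'n) set \<Rightarrow> real \<Rightarrow> ('n \<Rightarrow> 'n \<Rightarrow> real \<Rightarrow> real ^ 3) \<Rightarrow> (real \<Rightarrow> real ^ 'n)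
   \<Rightarrow> real \<Rightarrow> 'n \<Rightarrow> 'n \<Rightarrow> real" where
  "received_current Ea Ta \<phi> it t i j =
     (if (i, j) \<in> Ea \<and> t \<ge> Ta then it t $ j + k_vec \<bullet> \<phi> i j t else it t $ j)"

definition zts_attack ::
  "real ^ 3 ^ 3 \<Rightarrow> real ^ 2 ^ 3 \<Rightarrow> real ^ 2 \<Rightarrow> real \<Rightarrow> (real \<Rightarrow> real ^ 3) \<Rightarrow> bool" where
  "zts_attack A Eb d Ta \<phi> \<longleftrightarrow>
     Eb *v d \<noteq> 0 \<and> \<phi> Ta = 0 \<and>
     (\<forall>t\<ge>Ta. (\<phi> has_vector_derivative A *v \<phi> t + Eb *v d) (at t within {Ta..}))"

text \<open>As for every average at infinity, the limit is that of the averages; convergence of the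
  individual voltages is not required. For current sharing the individual limits must exist.\<close>

definition voltage_balancing :: "real \<Rightarrow> (real \<Rightarrow> real ^ 'n) \<Rightarrow> bool" where
  "voltage_balancing Vref v \<longleftrightarrow> ((\<lambda>t. avg (v t)) \<longlongrightarrow> Vref) at_top"

definition current_sharing :: "real ^ 'n \<Rightarrow> (real \<Rightarrow> real ^ 'n) \<Rightarrow> bool" where
  "current_sharing Is it \<longleftrightarrow>
     (\<exists>I. (\<forall>i. ((\<lambda>t. it t $ i) \<longlongrightarrow> I $ i) at_top) \<and>
          (\<forall>i j. I $ i / Is $ i = I $ j / Is $ j))"

end

theory Submission
  imports Defs "HOL-Computational_Algebra.Fundamental_Theorem_Algebra"
begin

text \<open>Summed over all DGUs, the consensus part of the control law cancels by symmetry, so only the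
  weighted attack signals drive \<open>\<Sum>\<psi>\<close>. Since \<open>\<phi>\<close> equals \<open>A\<^sup>-\<^sup>1 \<phi>' - A\<^sup>-\<^sup>1 e\<close> with \<open>e\<close> the constant
  attack input, cooperation removes the constant part and \<open>\<Sum>\<psi>\<close> is exactly the weighted sum of the
  \<open>k \<bullet> A\<^sup>-\<^sup>1 \<phi>\<close>, which converges because \<open>\<phi>\<close> tends to \<open>- A\<^sup>-\<^sup>1 e\<close>.
  If currents were shared, the derivative of \<open>\<psi>\<close> would tend to the vector \<open>c\<close> of weighted attack limits; as the
  currents converge, \<open>L c = 0\<close>, so \<open>c\<close> is constant, and cooperation forces \<open>c = 0\<close>.
  Decay of \<open>x' = A x\<close> for Hurwitz \<open>A\<close> avoids matrix exponentials and normal forms: a polynomial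
  annihilating \<open>A\<close> is split into linear factors, which are peeled off one at a time.\<close>

section \<open>Decay of linear systems with Hurwitz matrix\<close>

text \<open>Integrating factor: once \<open>h\<close> stays below \<open>m * e / 2\<close>, the
  function \<open>(y t - e / 2) * exp (m * t)\<close> is nonincreasing, so \<open>y\<close> exceeds
  \<open>e / 2\<close> by at most a multiple of \<open>exp (- m * t)\<close>.\<close>

lemma linear_differential_inequality_tendsto_0:
  fixes y y' h :: "real \<Rightarrow> real"
  assumes m: "m > 0"
    and y: "\<And>t. t > T \<Longrightarrow> (y has_real_derivative y' t) (at t)"
    and nonneg: "\<And>t. t > T \<Longrightarrow> y t \<ge> 0"
    and le: "\<And>t. t > T \<Longrightarrow> y' t \<le> - m * y t + h t"
    and h: "(h \<longlongrightarrow> 0) at_top"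
  shows "(y \<longlongrightarrow> 0) at_top"
proof (rule order_tendstoI)
  fix b :: real assume "b < 0"
  show "eventually (\<lambda>t. b < y t) at_top"
    using eventually_gt_at_top[of T] by eventually_elim (use nonneg \<open>b < 0\<close> in fastforce)
next
  fix e :: real assume e: "0 < e"
  have "eventually (\<lambda>t. h t < m * e / 2) at_top"
    using m e by (intro order_tendstoD(2)[OF h]) simp
  then obtain S0 where S0: "\<And>t. t \<ge> S0 \<Longrightarrow> h t < m * e / 2"
    by (auto simp: eventually_at_top_linorder)
  \<comment> \<open>The hypotheses hold only strictly beyond \<open>T\<close>, while the comparison
    starts at \<open>S\<close> itself; hence \<open>T + 1\<close>.\<close>
  define S where "S = max S0 (T + 1)"
  define F where "F = (\<lambda>t. (y t - e / 2) * exp (m * t))"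
  have dF: "\<exists>D. DERIV F t :> D \<and> D \<le> 0" if "t \<ge> S" for t
  proof (intro exI conjI)
    have t: "t > T" "t \<ge> S0" using that by (auto simp: S_def)
    show "DERIV F t :> exp (m * t) * (y' t + m * y t - m * e / 2)"
      unfolding F_def by (rule derivative_eq_intros y t refl | simp add: algebra_simps)+
    have "y' t + m * y t - m * e / 2 \<le> 0" using le[OF t(1)] S0[OF t(2)] by simp
    then show "exp (m * t) * (y' t + m * y t - m * e / 2) \<le> 0"
      by (simp add: mult_nonneg_nonpos)
  qed
  have bound: "y t \<le> e / 2 + F S * exp (- m * t)" if "t \<ge> S" for t
  proof -
    have "F t \<le> F S"
      using that dF by (intro DERIV_nonpos_imp_nonincreasing[of S t F]) auto
    then have "F t * exp (- m * t) \<le> F S * exp (- m * t)" by (rule mult_right_mono) simp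
    moreover have "F t * exp (- m * t) = y t - e / 2"
      by (simp add: F_def mult.assoc flip: exp_add)
    ultimately show ?thesis by linarith
  qed
  have "((\<lambda>t. exp (- m * t)) \<longlongrightarrow> 0) at_top"
    using m by (intro filterlim_compose[OF exp_at_bot] filterlim_tendsto_neg_mult_at_bot[OF tendsto_const]
        filterlim_ident) auto
  then have "((\<lambda>t. e / 2 + F S * exp (- m * t)) \<longlongrightarrow> e / 2 + F S * 0) at_top"
    by (intro tendsto_intros)
  then have "eventually (\<lambda>t. e / 2 + F S * exp (- m * t) < e) at_top"
    by (rule order_tendstoD(2)) (use e in simp)
  then show "eventually (\<lambda>t. y t < e) at_top"
    using eventually_ge_at_top[of S] by eventually_elim (use bound in fastforce)
qed

text \<open>The inner product on \<open>complex ^ 'm\<close> is the real one, that is, the real part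
  of the Hermitian product. The imaginary part of \<mu> only rotates \<open>u\<close> orthogonally
  to itself and contributes nothing.\<close>

lemma inner_scalar_mult_complex:
  fixes u :: "complex ^ 'm"
  shows "u \<bullet> (\<mu> *s u) = Re \<mu> * (norm u)\<^sup>2"
proof -
  have "z \<bullet> (\<mu> * z) = Re \<mu> * (norm z)\<^sup>2" for z :: complex
    unfolding cmod_power2 by (simp add: inner_complex_def algebra_simps power2_eq_square)
  then show ?thesis
    by (simp add: inner_vec_def power2_norm_eq_inner[of u] sum_distrib_left)
       (simp add: power2_norm_eq_inner)
qed

text \<open>Energy estimate: the derivative of the squared norm has the damping term
  \<open>2 * Re \<mu> * (norm (u t))\<^sup>2\<close>. Half of it absorbs the cross term with
  \<open>g\<close>, leaving a forcing that tends to 0.\<close>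

lemma asymptotic_eigenvector_ode_tendsto_0:
  fixes u g :: "real \<Rightarrow> complex ^ 'm"
  assumes \<mu>: "Re \<mu> < 0"
    and u: "\<And>t. t > T \<Longrightarrow> (u has_vector_derivative \<mu> *s u t + g t) (at t)"
    and g: "(g \<longlongrightarrow> 0) at_top"
  shows "(u \<longlongrightarrow> 0) at_top"
proof -
  define m where "m = - Re \<mu>"
  have m: "m > 0" using \<mu> by (simp add: m_def)
  have "((\<lambda>t. (norm (u t))\<^sup>2) \<longlongrightarrow> 0) at_top"
  proof (rule linear_differential_inequality_tendsto_0[OF m, where T = T])
    fix t assume t: "t > T"
    show "((\<lambda>t. (norm (u t))\<^sup>2) has_real_derivative 2 * (u t \<bullet> (\<mu> *s u t + g t))) (at t)"
      using has_derivative_inner[OF u[OF t, unfolded has_vector_derivative_def]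
            u[OF t, unfolded has_vector_derivative_def]]
      by (auto simp: has_field_derivative_def power2_norm_eq_inner fun_eq_iff inner_commute
          algebra_simps inner_left_distrib inner_right_distrib elim!: has_derivative_eq_rhs)
    have "2 * (u t \<bullet> g t) \<le> 2 * (norm (u t) * norm (g t))"
      using norm_cauchy_schwarz[of "u t" "g t"] by simp
    also have "\<dots> \<le> m * (norm (u t))\<^sup>2 + (norm (g t))\<^sup>2 / m"
    proof -
      \<comment> \<open>Young's inequality, weighted by \<open>m\<close> so that exactly half of the
        damping \<open>2 * m\<close> is spent.\<close>
      have "0 \<le> (m * norm (u t) - norm (g t))\<^sup>2 / m" using m by simp
      also have "\<dots> = m * (norm (u t))\<^sup>2 + (norm (g t))\<^sup>2 / m - 2 * (norm (u t) * norm (g t))"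
        using m by (simp add: field_simps power2_eq_square)
      finally show ?thesis by simp
    qed
    finally show "2 * (u t \<bullet> (\<mu> *s u t + g t)) \<le> - m * (norm (u t))\<^sup>2 + (norm (g t))\<^sup>2 / m"
      by (simp add: inner_right_distrib inner_scalar_mult_complex m_def algebra_simps)
  next
    have "((\<lambda>t. (norm (g t))\<^sup>2 / m) \<longlongrightarrow> (norm (0 :: complex ^ 'm))\<^sup>2 / m) at_top"
      using m by (intro tendsto_intros g) simp
    then show "((\<lambda>t. (norm (g t))\<^sup>2 / m) \<longlongrightarrow> 0) at_top" by simp
  qed simp
  then have "((\<lambda>t. sqrt ((norm (u t))\<^sup>2)) \<longlongrightarrow> sqrt 0) at_top"
    by (rule tendsto_real_sqrt)
  then show ?thesis by (simp add: tendsto_norm_zero_iff)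
qed

section \<open>Polynomials in a complex matrix\<close>

lemma matrix_vector_mult_bounded_linear_complex:
  fixes B :: "complex ^ 'm ^ 'k"
  shows "bounded_linear ((*v) B)"
  unfolding linear_conv_bounded_linear[symmetric]
  by (rule linearI)
     (simp_all add: matrix_vector_mult_def vec_eq_iff scaleR_sum_right distrib_left sum.distrib)

text \<open>The vector \<open>p(B) x\<close>, by Horner's scheme.\<close>

definition poly_apply :: "complex ^ 'm ^ 'm \<Rightarrow> complex poly \<Rightarrow> complex ^ 'm \<Rightarrow> complex ^ 'm" where
  "poly_apply B p = fold_coeffs (\<lambda>c f x. c *s x + f (B *v x)) p (\<lambda>_. 0)"

lemma poly_apply_0 [simp]: "poly_apply B 0 x = 0"
  by (simp add: poly_apply_def)

lemma poly_apply_pCons [simp]: "poly_apply B (pCons c p) x = c *s x + poly_apply B p (B *v x)"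
  \<comment> \<open>Only \<open>pCons 0 0 = 0\<close> escapes the recursion of
    \<open>fold_coeffs\<close>; both sides vanish there.\<close>
  by (cases "c = 0 \<and> p = 0") (auto simp: poly_apply_def)

lemma poly_apply_add: "poly_apply B (p + q) x = poly_apply B p x + poly_apply B q x"
  by (induction p q arbitrary: x rule: poly_induct2) (simp_all add: vector_sadd_rdistrib algebra_simps)

lemma poly_apply_smult: "poly_apply B (smult c p) x = c *s poly_apply B p x"
  by (induction p arbitrary: x) (simp_all add: vector_add_ldistrib vector_smult_assoc)

lemma poly_apply_vector_add:
  "poly_apply B p (x + y) = poly_apply B p x + poly_apply B p y"
  by (induction p arbitrary: x y) (simp_all add: vector_add_ldistrib matrix_vector_right_distrib algebra_simps)

lemma poly_apply_vector_scale:
  "poly_apply B p (c *s x) = c *s poly_apply B p x"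
  by (induction p arbitrary: x)
     (simp_all add: vector_add_ldistrib vector_smult_assoc mult.commute vector_scalar_commute)

text \<open>Moves a linear factor from the polynomial onto the vector. This lets an induction on the
  degree replace a trajectory \<open>w\<close> by \<open>(B - \<mu>) w\<close>.\<close>

lemma poly_apply_linear_factor:
  "poly_apply B ([:- \<mu>, 1:] * q) x = poly_apply B q (B *v x - \<mu> *s x)"
proof -
  have "poly_apply B (smult (- \<mu>) q + pCons 0 q) x = poly_apply B q (B *v x) + poly_apply B q ((- \<mu>) *s x)"
    by (simp only: poly_apply_add poly_apply_smult poly_apply_vector_scale poly_apply_pCons) simp
  also have "\<dots> = poly_apply B q (B *v x + (- \<mu>) *s x)"
    by (rule poly_apply_vector_add[symmetric])
  also have "B *v x + (- \<mu>) *s x = B *v x - \<mu> *s x"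
    by (simp add: vec_eq_iff)
  finally show ?thesis by (simp add: algebra_simps)
qed

lemma poly_apply_sum: "poly_apply B (\<Sum>i\<in>S. f i) x = (\<Sum>i\<in>S. poly_apply B (f i) x)"
  by (induction S rule: infinite_finite_induct) (simp_all add: poly_apply_add)

text \<open>Powers are kept as matrices, not as iterated actions on a vector, so that one linear
  dependence among them serves all \<open>x\<close> at once.\<close>

definition matpow :: "complex ^ 'm ^ 'm \<Rightarrow> nat \<Rightarrow> complex ^ 'm ^ 'm" where
  "matpow B n = ((**) B ^^ n) (mat 1)"

lemma poly_apply_monom: "poly_apply B (monom c n) x = c *s (matpow B n *v x)"
proof -
  have "poly_apply B (monom c n) x = c *s (((*v) B ^^ n) x)"
    by (induction n arbitrary: x) (simp_all add: monom_0 monom_Suc funpow_swap1)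
  moreover have "((*v) B ^^ n) x = matpow B n *v x"
    by (induction n) (simp_all add: matpow_def matrix_vector_mul_assoc)
  ultimately show ?thesis by simp
qed

text \<open>The powers of \<open>B\<close> live in a finite-dimensional space, so they are linearly dependent.\<close>

lemma annihilating_polynomial_exists:
  fixes B :: "complex ^ 'm ^ 'm"
  obtains p where "p \<noteq> 0" "\<And>x. poly_apply B p x = 0"
proof (cases "inj (matpow B)")
  case True
  then have "infinite (range (matpow B))" by (simp add: finite_image_iff)
  \<comment> \<open>Dependence is meant over the reals, the matrices forming a finite-dimensional
    real space; the real coefficients are embedded into the complex numbers below.\<close>
  then have "dependent (range (matpow B))" using independent_imp_finite by blast
  then obtain S c w where S: "finite S" "S \<subseteq> range (matpow B)"
    and sum: "(\<Sum>M\<in>S. c M *\<^sub>R M) = 0" and w: "w \<in> S" "c w \<noteq> 0"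
    unfolding dependent_explicit by blast
  define I where "I = matpow B -` S"
  have I: "finite I" "S = matpow B ` I"
    unfolding I_def using S True by (auto intro: finite_vimageI)
  define p where "p = (\<Sum>i\<in>I. monom (complex_of_real (c (matpow B i))) i)"
  have coeff: "coeff p i = c (matpow B i)" if "i \<in> I" for i
    using that I(1) by (simp add: p_def coeff_sum)
  show ?thesis
  proof
    show "p \<noteq> 0" using w I coeff by fastforce
    fix x
    have "poly_apply B p x = (\<Sum>i\<in>I. (c (matpow B i) *\<^sub>R matpow B i) *v x)"
      unfolding p_def poly_apply_sum poly_apply_monom
      by (intro sum.cong refl)
         (simp add: vec_eq_iff matrix_vector_mult_def sum_distrib_left scaleR_conv_of_real[where 'a = complex] mult.assoc)
    also have "\<dots> = (\<Sum>i\<in>I. c (matpow B i) *\<^sub>R matpow B i) *v x"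
      by (induction I rule: infinite_finite_induct) (simp_all add: matrix_vector_mult_add_rdistrib)
    also have "(\<Sum>i\<in>I. c (matpow B i) *\<^sub>R matpow B i) = (\<Sum>M\<in>S. c M *\<^sub>R M)"
      unfolding I(2) using True by (subst sum.reindex) (auto intro: inj_on_subset)
    finally show "poly_apply B p x = 0" using sum by simp
  qed
next
  \<comment> \<open>The set of powers may now be finite and independent, but two equal powers give
    the polynomial \<open>X^i - X^j\<close> directly.\<close>
  case False
  then obtain i j where ij: "i \<noteq> j" "matpow B i = matpow B j" by (auto simp: inj_on_def)
  show ?thesis
  proof
    show "monom 1 i + monom (- 1) j \<noteq> (0 :: complex poly)"
    proof
      assume "monom 1 i + monom (- 1) j = (0 :: complex poly)"
      then have "coeff (monom 1 i + monom (- 1) j) i = (0 :: complex)" by simp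
      with ij show False by simp
    qed
    show "poly_apply B (monom 1 i + monom (- 1) j) x = 0" for x
      using ij by (simp add: poly_apply_add poly_apply_monom)
  qed
qed

text \<open>For a root \<open>\<mu>\<close> of \<open>p\<close>, \<open>u = (B - \<mu>) w\<close> is again a trajectory and is annihilated by \<open>p / (X - \<mu>)\<close>,
  so it decays. Then \<open>w\<close> decays too: by stability if \<open>\<mu>\<close> is an eigenvalue, and otherwise because
  \<open>B - \<mu>\<close> is invertible.\<close>

lemma tendsto_0_if_annihilated:
  fixes B :: "complex ^ 'm ^ 'm" and w :: "real \<Rightarrow> complex ^ 'm"
  assumes stable: "\<And>\<mu> x. x \<noteq> 0 \<Longrightarrow> B *v x = \<mu> *s x \<Longrightarrow> Re \<mu> < 0"
    and "p \<noteq> 0"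
    and "\<And>t. t > T \<Longrightarrow> (w has_vector_derivative B *v w t) (at t)"
    and "\<And>t. t > T \<Longrightarrow> poly_apply B p (w t) = 0"
  shows "(w \<longlongrightarrow> 0) at_top"
  using assms(2-4)
proof (induction "degree p" arbitrary: p w)
  case 0
  \<comment> \<open>A nonzero constant annihilates only the zero vector.\<close>
  then obtain c where c: "p = [:c:]" "c \<noteq> 0"
    by (metis degree_eq_zeroE pCons_eq_0_iff)
  have "w t = 0" if "t > T" for t
    using 0(4)[OF that] c by (simp add: vec_eq_iff)
  then have "eventually (\<lambda>t. w t = 0) at_top"
    using eventually_gt_at_top[of T] by (rule eventually_mono[rotated])
  then show ?case by (rule tendsto_eventually)
next
  case (Suc n)
  have "\<not> constant (poly p)" using Suc(2) by (simp add: constant_degree)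
  then obtain \<mu> where "poly p \<mu> = 0" using fundamental_theorem_of_algebra by blast
  then obtain q where q: "p = [:- \<mu>, 1:] * q" by (auto simp: poly_eq_0_iff_dvd)
  have "q \<noteq> 0" using Suc.prems(1) q by auto
  then have deg: "n = degree q"
    using Suc(2) q by (subst (asm) q, subst (asm) degree_mult_eq) auto
  define u where "u = (\<lambda>t. B *v w t - \<mu> *s w t)"
  have bl: "bounded_linear (\<lambda>x. B *v x - \<mu> *s x)"
    using matrix_vector_mult_bounded_linear_complex[of B]
    by (intro bounded_linear_sub iffD1[OF linear_conv_bounded_linear, of "(*s) \<mu>"] linearI)
       (auto simp: vec_eq_iff algebra_simps)
  have u: "(u \<longlongrightarrow> 0) at_top"
  proof (rule Suc(1)[OF deg \<open>q \<noteq> 0\<close>])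
    fix t assume t: "t > T"
    show "poly_apply B q (u t) = 0"
      using Suc.prems(3)[OF t] by (simp add: q poly_apply_linear_factor u_def del: mult_pCons_left)
    show "(u has_vector_derivative B *v u t) (at t)"
      using bounded_linear.has_vector_derivative[OF bl Suc.prems(2)[OF t]]
      by (simp add: u_def matrix_vector_mult_diff_distrib vector_scalar_commute)
  qed
  show ?case
  proof (cases "\<exists>x. x \<noteq> 0 \<and> B *v x = \<mu> *s x")
    case True
    then have "Re \<mu> < 0" using stable by blast
    then show ?thesis
    proof (rule asymptotic_eigenvector_ode_tendsto_0[OF _ _ u])
      fix t assume "t > T"
      with Suc.prems(2)[OF this] show "(w has_vector_derivative \<mu> *s w t + u t) (at t)"
        by (simp add: u_def)
    qed
  next
    case False
    define D where "D = B - mat \<mu>"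
    have mat: "mat \<mu> *v x = \<mu> *s x" for x :: "complex ^ 'm"
      by (simp add: mat_def matrix_vector_mult_def vec_eq_iff if_distrib[of "\<lambda>x. x * _"] cong: if_cong)
    have D: "D *v x = B *v x - \<mu> *s x" for x
      by (simp add: D_def matrix_vector_mult_diff_rdistrib mat)
    have "\<forall>x. D *v x = 0 \<longrightarrow> x = 0" using False by (auto simp: D)
    then obtain C where C: "C ** D = mat 1" using matrix_left_invertible_ker by blast
    have "w = (\<lambda>t. C *v u t)"
      using C by (simp add: u_def D[symmetric] matrix_vector_mul_assoc)
    moreover have "((\<lambda>t. C *v u t) \<longlongrightarrow> C *v 0) at_top"
      by (intro bounded_linear.tendsto[OF matrix_vector_mult_bounded_linear_complex] u)
    ultimately show ?thesis by simp
  qed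
qed

text \<open>Complexification: the entrywise embedding \<open>cplx\<close> intertwines
  \<open>A\<close> with its complex copy \<open>B\<close>, whose eigenvalues the Hurwitz condition
  controls. Real parts then recover \<open>x\<close>.\<close>

lemma hurwitz_ode_tendsto_0:
  fixes A :: "real ^ 'm ^ 'm" and x :: "real \<Rightarrow> real ^ 'm"
  assumes "hurwitz A"
    and x: "\<And>t. t > T \<Longrightarrow> (x has_vector_derivative A *v x t) (at t)"
  shows "(x \<longlongrightarrow> 0) at_top"
proof -
  define B :: "complex ^ 'm ^ 'm" where "B = (\<chi> i j. complex_of_real (A $ i $ j))"
  define cplx :: "real ^ 'm \<Rightarrow> complex ^ 'm" where "cplx = (\<lambda>y. \<chi> i. complex_of_real (y $ i))"
  have bl: "bounded_linear cplx"
    unfolding linear_conv_bounded_linear[symmetric]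
    by (rule linearI) (auto simp: cplx_def vec_eq_iff scaleR_conv_of_real[where 'a = complex])
  have B: "cplx (A *v y) = B *v cplx y" for y
    by (simp add: cplx_def B_def matrix_vector_mult_def vec_eq_iff)
  obtain p where p: "p \<noteq> 0" "\<And>y. poly_apply B p y = 0"
    using annihilating_polynomial_exists by blast
  have "((\<lambda>t. cplx (x t)) \<longlongrightarrow> 0) at_top"
  proof (rule tendsto_0_if_annihilated[OF _ p(1)])
    show "Re \<mu> < 0" if "y \<noteq> 0" "B *v y = \<mu> *s y" for \<mu> y
      using assms(1) that unfolding hurwitz_def B_def by blast
    show "((\<lambda>t. cplx (x t)) has_vector_derivative B *v cplx (x t)) (at t)" if "t > T" for t
      using bounded_linear.has_vector_derivative[OF bl x[OF that]] by (simp add: B)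
  qed (rule p(2))
  then have "((\<lambda>t. Re (cplx (x t) $ i)) \<longlongrightarrow> Re ((0 :: complex ^ 'm) $ i)) at_top" for i
    by (intro tendsto_intros)
  then show ?thesis by (intro vec_tendstoI) (simp add: cplx_def)
qed

text \<open>A nonzero kernel vector would be an eigenvector for the eigenvalue 0, whose real part is
  not negative.\<close>

lemma hurwitz_invertible:
  fixes A :: "real ^ 'm ^ 'm"
  assumes "hurwitz A"
  shows "invertible A"
proof -
  have "y = 0" if y: "A *v y = 0" for y
  proof (rule ccontr)
    assume "y \<noteq> 0"
    define z :: "complex ^ 'm" where "z = (\<chi> i. complex_of_real (y $ i))"
    have "z \<noteq> 0" using \<open>y \<noteq> 0\<close> by (auto simp: z_def vec_eq_iff)
    moreover have "(\<chi> i j. complex_of_real (A $ i $ j)) *v z = 0 *s z"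
    proof -
      have "(\<Sum>j\<in>UNIV. complex_of_real (A $ i $ j) * complex_of_real (y $ j)) = complex_of_real ((A *v y) $ i)" for i
        by (simp add: matrix_vector_mult_def)
      then show ?thesis
        unfolding y by (simp add: z_def matrix_vector_mult_def[of "\<chi> i j. complex_of_real (A $ i $ j)"] vec_eq_iff)
    qed
    ultimately show False using assms unfolding hurwitz_def by force
  qed
  then show ?thesis by (simp add: invertible_left_inverse matrix_left_invertible_ker)
qed

text \<open>By the mean value theorem on \<open>[t, t + 1]\<close>, the derivative at some
  \<open>z t > t\<close> equals \<open>f (t + 1) - f t\<close>, which tends to 0. Convergence of
  \<open>f\<close> alone would not make \<open>f'\<close> converge.\<close>

lemma convergent_derivative_limit_0:
  fixes f :: "real \<Rightarrow> real"
  assumes f: "(f \<longlongrightarrow> L) at_top"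
    and deriv: "\<And>t. t > T \<Longrightarrow> (f has_real_derivative f' t) (at t)"
    and f': "(f' \<longlongrightarrow> l) at_top"
  shows "l = 0"
proof -
  have "\<exists>z>t. f (t + 1) - f t = f' z" if "t > T" for t
  proof -
    have "\<exists>z>t. z < t + 1 \<and> f (t + 1) - f t = (t + 1 - t) * f' z"
      using that by (intro MVT2 deriv) auto
    then show ?thesis by auto
  qed
  then obtain z where z: "\<And>t. t > T \<Longrightarrow> z t > t \<and> f (t + 1) - f t = f' (z t)"
    by metis
  have "eventually (\<lambda>t. t \<le> z t) at_top"
    using eventually_gt_at_top[of T] by eventually_elim (use z in force)
  then have "filterlim z at_top at_top"
    by (rule filterlim_at_top_mono[OF filterlim_ident])
  then have "((\<lambda>t. f' (z t)) \<longlongrightarrow> l) at_top" by (rule filterlim_compose[OF f'])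
  moreover have "((\<lambda>t. f' (z t)) \<longlongrightarrow> 0) at_top"
  proof (rule Lim_transform_eventually)
    have "filterlim (\<lambda>t. t + 1 :: real) at_top at_top"
      by (rule filterlim_at_top_mono[OF filterlim_ident]) simp
    then have "((\<lambda>t. f (t + 1)) \<longlongrightarrow> L) at_top" by (rule filterlim_compose[OF f])
    from tendsto_diff[OF this f] show "((\<lambda>t. f (t + 1) - f t) \<longlongrightarrow> 0) at_top" by simp
    show "eventually (\<lambda>t. f (t + 1) - f t = f' (z t)) at_top"
      using eventually_gt_at_top[of T] by eventually_elim (use z in blast)
  qed
  ultimately show ?thesis by (rule tendsto_unique[rotated]) simp
qed

section \<open>Weighted graphs and their Laplacian\<close>

lemma sum_links:
  fixes S :: "('n::finite \<times> 'n) set" and f :: "'n \<Rightarrow> 'n \<Rightarrow> 'b::comm_monoid_add"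
  shows "(\<Sum>(i, j)\<in>S. f i j) = (\<Sum>i\<in>UNIV. \<Sum>j\<in>neighbours S i. f i j)"
proof -
  have "S = Sigma UNIV (neighbours S)" by (auto simp: neighbours_def)
  moreover have "(\<Sum>i\<in>UNIV. \<Sum>j\<in>neighbours S i. f i j) = (\<Sum>(i, j)\<in>Sigma UNIV (neighbours S). f i j)"
    by (rule sum.Sigma) auto
  ultimately show ?thesis by simp
qed

text \<open>Reversing every link permutes \<open>E\<close> and negates each term, so the sum equals
  its own negative. This cancels the consensus flows.\<close>

lemma sum_antisymmetric_links:
  fixes E :: "('n::finite \<times> 'n) set" and f :: "'n \<Rightarrow> 'n \<Rightarrow> real"
  assumes "sym E" and "\<And>i j. (i, j) \<in> E \<Longrightarrow> f j i = - f i j"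
  shows "(\<Sum>i\<in>UNIV. \<Sum>j\<in>neighbours E i. f i j) = 0"
proof -
  have "(\<Sum>(i, j)\<in>E. f i j) = (\<Sum>(i, j)\<in>E. f j i)"
    using assms(1) by (intro sum.reindex_bij_witness[of _ prod.swap prod.swap]) (auto dest: symD)
  also have "\<dots> = (\<Sum>(i, j)\<in>E. - f i j)"
    using assms(2) by (intro sum.cong) auto
  also have "\<dots> = - (\<Sum>(i, j)\<in>E. f i j)"
    by (simp add: case_prod_beta sum_negf)
  finally show ?thesis by (simp add: sum_links)
qed

lemma laplacian_mult_vec:
  fixes E :: "('n::finite \<times> 'n) set"
  assumes "irrefl E"
  shows "(laplacian E a *v x) $ i = (\<Sum>j\<in>neighbours E i. a i j * (x $ i - x $ j))"
proof -
  have ii: "(i, i) \<notin> E" using assms by (auto simp: irrefl_def)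
  \<comment> \<open>The diagonal and off-diagonal parts of the row can be added because, without
    self-loops, they are never both active.\<close>
  have "(laplacian E a *v x) $ i = (\<Sum>j\<in>UNIV. (if j = i then (\<Sum>k\<in>neighbours E i. a i k) * x $ i else 0)
      + (if j \<in> neighbours E i then - a i j * x $ j else 0))"
    unfolding laplacian_def matrix_vector_mult_def
    using ii by (auto intro!: sum.cong simp: neighbours_def)
  also have "\<dots> = (\<Sum>k\<in>neighbours E i. a i k) * x $ i + (\<Sum>j\<in>neighbours E i. - a i j * x $ j)"
    unfolding sum.distrib by (simp add: sum.If_cases)
  also have "\<dots> = (\<Sum>j\<in>neighbours E i. a i j * x $ i + - a i j * x $ j)"
    by (simp only: sum.distrib sum_distrib_right)
  also have "\<dots> = (\<Sum>j\<in>neighbours E i. a i j * (x $ i - x $ j))"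
    by (simp add: right_diff_distrib)
  finally show ?thesis .
qed

text \<open>Maximum principle: a maximal entry forces all neighbouring entries to be maximal.\<close>

lemma laplacian_kernel_constant:
  fixes E :: "('n::finite \<times> 'n) set"
  assumes graph: "connected_weighted_graph E a" and ker: "laplacian E a *v x = 0"
  shows "x $ i = x $ j"
proof -
  define m where "m = Max (range (($) x))"
  have le: "x $ k \<le> m" for k by (simp add: m_def)
  have "m \<in> range (($) x)" unfolding m_def by (intro Max_in) auto
  then obtain i0 where i0: "x $ i0 = m" by auto
  have spread: "x $ l = m" if "x $ k = m" "(k, l) \<in> E" for k l
  proof -
    have pos: "a k l' > 0" if "l' \<in> neighbours E k" for l'
      using graph that by (auto simp: connected_weighted_graph_def neighbours_def)
    have "(\<Sum>l'\<in>neighbours E k. a k l' * (x $ k - x $ l')) = 0"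
      using graph ker laplacian_mult_vec[of E a x k] by (simp add: connected_weighted_graph_def)
    moreover have "a k l' * (x $ k - x $ l') \<ge> 0" if "l' \<in> neighbours E k" for l'
      using pos[OF that] le[of l'] \<open>x $ k = m\<close> by simp
    ultimately have "\<forall>l'\<in>neighbours E k. a k l' * (x $ k - x $ l') = 0"
      by (subst (asm) sum_nonneg_eq_0_iff) auto
    moreover have "l \<in> neighbours E k" using that by (simp add: neighbours_def)
    ultimately show ?thesis using pos that by force
  qed
  have "x $ k = m" for k
  proof -
    have "(i0, k) \<in> E\<^sup>*" using graph by (simp add: connected_weighted_graph_def)
    then show ?thesis by induction (use i0 spread in blast)+
  qed
  then show ?thesis by simp
qed

section \<open>Attacked trajectories\<close>

lemma matrix_inv_vector_cancel:
  fixes A :: "'a::field ^ 'm ^ 'm"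
  assumes "invertible A"
  shows "matrix_inv A *v (A *v x) = x" "A *v (matrix_inv A *v x) = x"
proof -
  have "A ** matrix_inv A = mat 1 \<and> matrix_inv A ** A = mat 1"
    using assms unfolding matrix_inv_def invertible_def by (rule someI_ex)
  then show "matrix_inv A *v (A *v x) = x" "A *v (matrix_inv A *v x) = x"
    by (simp_all add: matrix_vector_mul_assoc)
qed

text \<open>The limit is the equilibrium of the attack dynamics; the deviation from it solves the
  homogeneous Hurwitz system.\<close>

lemma zts_attack_tendsto:
  assumes "hurwitz A" and attack: "zts_attack A Eb d Ta \<phi>"
  shows "(\<phi> \<longlongrightarrow> - (matrix_inv A *v (Eb *v d))) at_top"
proof -
  define e where "e = matrix_inv A *v (Eb *v d)"
  have Ae: "A *v e = Eb *v d"
    using hurwitz_invertible[OF assms(1)] by (simp add: e_def matrix_inv_vector_cancel)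
  have "((\<lambda>t. \<phi> t + e) \<longlongrightarrow> 0) at_top"
  proof (rule hurwitz_ode_tendsto_0[OF assms(1)])
    fix t assume t: "t > Ta"
    have "(\<phi> has_vector_derivative A *v \<phi> t + Eb *v d) (at t within {Ta..})"
      using attack t by (simp add: zts_attack_def)
    then have "(\<phi> has_vector_derivative A *v \<phi> t + Eb *v d) (at t)"
      using t at_within_interior[of t "{Ta..}"] by (simp add: interior_real_atLeast)
    from has_vector_derivative_add[OF this has_vector_derivative_const[of e]]
    show "((\<lambda>t. \<phi> t + e) has_vector_derivative A *v (\<phi> t + e)) (at t)"
      by (simp add: matrix_vector_right_distrib Ae)
  qed
  from tendsto_diff[OF this tendsto_const[of e]] show ?thesis by (simp add: e_def)
qed

text \<open>Applying \<open>matrix_inv A\<close> to the attack dynamics leaves \<phi> plus a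
  constant, so the time integral of the attack signal is explicit up to a linear drift.\<close>

lemma zts_attack_antiderivative:
  assumes "hurwitz A" and attack: "zts_attack A Eb d Ta \<phi>" and t: "t \<ge> Ta"
  shows "((\<lambda>t. k \<bullet> (matrix_inv A *v \<phi> t)) has_real_derivative
           k \<bullet> \<phi> t + k \<bullet> (matrix_inv A *v (Eb *v d))) (at t within {Ta..})"
proof -
  have "(\<phi> has_vector_derivative A *v \<phi> t + Eb *v d) (at t within {Ta..})"
    using attack t by (simp add: zts_attack_def)
  moreover have "bounded_linear (\<lambda>x. k \<bullet> (matrix_inv A *v x))"
    by (intro bounded_linear_compose[OF bounded_linear_inner_right]) simp
  ultimately have "((\<lambda>t. k \<bullet> (matrix_inv A *v \<phi> t)) has_vector_derivative
      k \<bullet> (matrix_inv A *v (A *v \<phi> t + Eb *v d))) (at t within {Ta..})"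
    using bounded_linear.has_vector_derivative by fastforce
  then show ?thesis
    using hurwitz_invertible[OF assms(1)]
    by (simp add: has_real_derivative_iff_has_vector_derivative matrix_vector_right_distrib
        inner_right_distrib matrix_inv_vector_cancel)
qed

text \<open>Splits the control law into nominal consensus and an additive attack input, so that the
  two can be treated separately.\<close>

lemma attacked_trajectory_derivative:
  assumes traj: "microgrid_trajectory E a Vref kI Is il (received_current Ea Ta \<phi> it) v it \<psi>"
    and "Ea \<subseteq> E" and "t \<ge> 0"
  shows "((\<lambda>s. \<psi> s $ i) has_real_derivative
           - kI * (\<Sum>j\<in>neighbours E i. a i j * (it t $ i / Is $ i - it t $ j / Is $ j))
           + (if t \<ge> Ta then \<Sum>j\<in>neighbours Ea i. kI * a i j / Is $ j * (k_vec \<bullet> \<phi> i j t) else 0))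
         (at t within {0..})"
proof -
  have sub: "neighbours Ea i \<subseteq> neighbours E i" using assms(2) by (auto simp: neighbours_def)
  \<comment> \<open>The attack input is extended by 0 to all neighbours, so that it can be summed
    together with the consensus terms and restricted to \<open>Ea\<close> afterwards.\<close>
  define P where "P = (\<lambda>j. if j \<in> neighbours Ea i \<and> t \<ge> Ta then kI * a i j / Is $ j * (k_vec \<bullet> \<phi> i j t) else 0)"
  have "- kI * (\<Sum>j\<in>neighbours E i. a i j * (it t $ i / Is $ i - received_current Ea Ta \<phi> it t i j / Is $ j))
      = (\<Sum>j\<in>neighbours E i. - kI * (a i j * (it t $ i / Is $ i - it t $ j / Is $ j)) + P j)"
    unfolding sum_distrib_left
    by (intro sum.cong refl)
       (auto simp: received_current_def P_def neighbours_def add_divide_distrib algebra_simps)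
  also have "\<dots> = - kI * (\<Sum>j\<in>neighbours E i. a i j * (it t $ i / Is $ i - it t $ j / Is $ j))
      + (\<Sum>j\<in>neighbours E i. P j)"
    by (simp only: sum.distrib sum_distrib_left)
  also have "(\<Sum>j\<in>neighbours E i. P j) = (\<Sum>j\<in>neighbours Ea i. P j)"
    using sub by (intro sum.mono_neutral_right) (auto simp: P_def)
  also have "\<dots> = (if t \<ge> Ta then \<Sum>j\<in>neighbours Ea i. kI * a i j / Is $ j * (k_vec \<bullet> \<phi> i j t) else 0)"
    by (simp add: P_def)
  finally have "- kI * (\<Sum>j\<in>neighbours E i. a i j * (it t $ i / Is $ i - received_current Ea Ta \<phi> it t i j / Is $ j))
      = - kI * (\<Sum>j\<in>neighbours E i. a i j * (it t $ i / Is $ i - it t $ j / Is $ j))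
      + (if t \<ge> Ta then \<Sum>j\<in>neighbours Ea i. kI * a i j / Is $ j * (k_vec \<bullet> \<phi> i j t) else 0)" .
  moreover have "((\<lambda>s. \<psi> s $ i) has_real_derivative
      - kI * (\<Sum>j\<in>neighbours E i. a i j * (it t $ i / Is $ i - received_current Ea Ta \<phi> it t i j / Is $ j)))
      (at t within {0..})"
    using traj \<open>t \<ge> 0\<close> unfolding microgrid_trajectory_def by blast
  ultimately show ?thesis by metis
qed

lemma sum_control_derivative:
  fixes E :: "('n::finite \<times> 'n) set"
  assumes graph: "connected_weighted_graph E a"
    and traj: "microgrid_trajectory E a Vref kI Is il (received_current Ea Ta \<phi> it) v it \<psi>"
    and "Ea \<subseteq> E" and "t \<ge> 0"
  shows "((\<lambda>s. \<Sum>i\<in>UNIV. \<psi> s $ i) has_real_derivative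
           (if t \<ge> Ta then \<Sum>(i, j)\<in>Ea. kI * a i j / Is $ j * (k_vec \<bullet> \<phi> i j t) else 0))
         (at t within {0..})"
proof -
  have "(\<Sum>i\<in>UNIV. \<Sum>j\<in>neighbours E i. a i j * (it t $ i / Is $ i - it t $ j / Is $ j)) = 0"
    using graph
    by (intro sum_antisymmetric_links) (auto simp: connected_weighted_graph_def algebra_simps)
  moreover have "(\<Sum>i\<in>UNIV. if t \<ge> Ta then \<Sum>j\<in>neighbours Ea i. kI * a i j / Is $ j * (k_vec \<bullet> \<phi> i j t) else 0)
      = (if t \<ge> Ta then \<Sum>(i, j)\<in>Ea. kI * a i j / Is $ j * (k_vec \<bullet> \<phi> i j t) else 0)"
    by (cases "t \<ge> Ta") (simp_all only: sum_links if_True if_False sum.neutral_const)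
  moreover have "((\<lambda>s. \<Sum>i\<in>UNIV. \<psi> s $ i) has_real_derivative
      (\<Sum>i\<in>UNIV. - kI * (\<Sum>j\<in>neighbours E i. a i j * (it t $ i / Is $ i - it t $ j / Is $ j))
           + (if t \<ge> Ta then \<Sum>j\<in>neighbours Ea i. kI * a i j / Is $ j * (k_vec \<bullet> \<phi> i j t) else 0)))
      (at t within {0..})"
    by (intro DERIV_sum attacked_trajectory_derivative[OF traj] assms(3,4))
  ultimately show ?thesis
    by (simp only: sum.distrib sum_distrib_left[symmetric] mult_zero_right add_0_left)
qed

text \<open>The total is constant up to \<open>Ta\<close>. Afterwards it has the same derivative as
  the weighted sum of antiderivatives, which starts at 0. For empty \<open>Ea\<close> this is
  conservation of the total without attack.\<close>

lemma sum_control_eq: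
  fixes E :: "('n::finite \<times> 'n) set"
  assumes graph: "connected_weighted_graph E a"
    and traj: "microgrid_trajectory E a Vref kI Is il (received_current Ea Ta \<phi> it) v it \<psi>"
    and links: "Ea \<subseteq> E"
    and hurwitz: "\<And>j. hurwitz (A j)"
    and attacks: "\<And>i j. (i, j) \<in> Ea \<Longrightarrow> zts_attack (A j) (Eb j) (d i j) Ta (\<phi> i j)"
    and cooperative: "(\<Sum>(i, j)\<in>Ea. kI * a i j / Is $ j * (k_vec \<bullet> (matrix_inv (A j) *v (Eb j *v d i j)))) = 0"
    and Ta: "0 \<le> Ta" "Ta \<le> t"
  shows "(\<Sum>i\<in>UNIV. \<psi> t $ i) = (\<Sum>i\<in>UNIV. \<psi> 0 $ i)
           + (\<Sum>(i, j)\<in>Ea. kI * a i j / Is $ j * (k_vec \<bullet> (matrix_inv (A j) *v \<phi> i j t)))"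
proof -
  let ?\<Psi> = "\<lambda>s. \<Sum>i\<in>UNIV. \<psi> s $ i"
  let ?w = "\<lambda>i j. kI * a i j / Is $ j"
  let ?G = "\<lambda>s. \<Sum>(i, j)\<in>Ea. ?w i j * (k_vec \<bullet> (matrix_inv (A j) *v \<phi> i j s))"
  have zero: "\<phi> i j Ta = 0" if "(i, j) \<in> Ea" for i j
    using attacks[OF that] by (simp add: zts_attack_def)
  note deriv = sum_control_derivative[OF graph traj links]
  have "\<exists>c. \<forall>s\<in>{0..Ta}. ?\<Psi> s = c"
  proof (rule has_field_derivative_zero_constant)
    fix s assume s: "s \<in> {0..Ta}"
    \<comment> \<open>At \<open>s = Ta\<close> the attack branch is already active, but \<phi>
      starts at 0.\<close>
    have "(if s \<ge> Ta then \<Sum>(i, j)\<in>Ea. ?w i j * (k_vec \<bullet> \<phi> i j s) else 0) = 0"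
      using s zero by (auto intro!: sum.neutral)
    with deriv[of s] s have "(?\<Psi> has_real_derivative 0) (at s within {0..})" by simp
    then show "(?\<Psi> has_real_derivative 0) (at s within {0..Ta})"
      by (rule DERIV_subset) auto
  qed simp
  then have \<Psi>Ta: "?\<Psi> Ta = ?\<Psi> 0" using Ta(1) by auto
  have "\<exists>c. \<forall>s\<in>{Ta..}. ?\<Psi> s - ?G s = c"
  proof (rule has_field_derivative_zero_constant)
    fix s assume s: "s \<in> {Ta..}"
    have "(?\<Psi> has_real_derivative (\<Sum>(i, j)\<in>Ea. ?w i j * (k_vec \<bullet> \<phi> i j s))) (at s within {Ta..})"
      using deriv[of s] s Ta(1) by (intro DERIV_subset[of _ _ s "{0..}" "{Ta..}"]) auto
    moreover have "(?G has_real_derivative (\<Sum>(i, j)\<in>Ea. ?w i j *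
        (k_vec \<bullet> \<phi> i j s + k_vec \<bullet> (matrix_inv (A j) *v (Eb j *v d i j))))) (at s within {Ta..})"
      unfolding case_prod_beta
      by (intro DERIV_sum DERIV_cmult zts_attack_antiderivative hurwitz attacks) (use s in auto)
    \<comment> \<open>Cooperation cancels the constant terms, hence the linear drift of the
      total.\<close>
    moreover have "(\<Sum>(i, j)\<in>Ea. ?w i j * (k_vec \<bullet> \<phi> i j s + k_vec \<bullet> (matrix_inv (A j) *v (Eb j *v d i j))))
        = (\<Sum>(i, j)\<in>Ea. ?w i j * (k_vec \<bullet> \<phi> i j s))"
      using cooperative by (simp add: case_prod_beta distrib_left sum.distrib)
    ultimately show "((\<lambda>s. ?\<Psi> s - ?G s) has_real_derivative 0) (at s within {Ta..})"
      using DERIV_diff by fastforce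
  qed simp
  then have "?\<Psi> t - ?G t = ?\<Psi> Ta - ?G Ta" using Ta by auto
  moreover have "?G Ta = 0" using zero by (auto intro!: sum.neutral)
  ultimately show ?thesis using \<Psi>Ta by simp
qed

lemma current_sharing_imp_attack_limits_0:
  fixes E :: "('n::finite \<times> 'n) set"
  assumes graph: "connected_weighted_graph E a"
    and traj: "microgrid_trajectory E a Vref kI Is il (received_current Ea Ta \<phi> it) v it \<psi>"
    and links: "Ea \<subseteq> E"
    and \<phi>: "\<And>i j. (i, j) \<in> Ea \<Longrightarrow> (\<phi> i j \<longlongrightarrow> p i j) at_top"
    and cooperative: "(\<Sum>(i, j)\<in>Ea. kI * a i j / Is $ j * (k_vec \<bullet> p i j)) = 0"
    and sharing: "current_sharing Is it"
  shows "(\<Sum>j\<in>neighbours Ea i. kI * a i j / Is $ j * (k_vec \<bullet> p i j)) = 0"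
proof -
  define c :: "real ^ 'n" where
    "c = (\<chi> i. \<Sum>j\<in>neighbours Ea i. kI * a i j / Is $ j * (k_vec \<bullet> p i j))"
  obtain I where I: "\<And>i. ((\<lambda>t. it t $ i) \<longlongrightarrow> I $ i) at_top"
    and ratio: "\<And>i j. I $ i / Is $ i = I $ j / Is $ j"
    using sharing unfolding current_sharing_def by blast
  define D where "D = (\<lambda>i t. - kI * (\<Sum>j\<in>neighbours E i. a i j * (it t $ i / Is $ i - it t $ j / Is $ j))
           + (if t \<ge> Ta then \<Sum>j\<in>neighbours Ea i. kI * a i j / Is $ j * (k_vec \<bullet> \<phi> i j t) else 0))"
  have D_lim: "(D i \<longlongrightarrow> c $ i) at_top" for i
  proof -
    have div: "((\<lambda>t. it t $ k / Is $ k) \<longlongrightarrow> I $ k / Is $ k) at_top" for k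
      unfolding divide_inverse by (intro tendsto_mult I tendsto_const)
    have "((\<lambda>t. - kI * (\<Sum>j\<in>neighbours E i. a i j * (it t $ i / Is $ i - it t $ j / Is $ j)))
        \<longlongrightarrow> - kI * (\<Sum>j\<in>neighbours E i. a i j * (I $ i / Is $ i - I $ j / Is $ j))) at_top"
      by (intro tendsto_intros div)
    moreover have "- kI * (\<Sum>j\<in>neighbours E i. a i j * (I $ i / Is $ i - I $ j / Is $ j)) = 0"
    proof -
      have "I $ i / Is $ i - I $ j / Is $ j = 0" for j using ratio[of i j] by simp
      then show ?thesis by (simp only: mult_zero_right sum.neutral_const)
    qed
    moreover have "((\<lambda>t. if t \<ge> Ta then \<Sum>j\<in>neighbours Ea i. kI * a i j / Is $ j * (k_vec \<bullet> \<phi> i j t) else 0)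
        \<longlongrightarrow> c $ i) at_top"
    proof (rule Lim_transform_eventually)
      show "((\<lambda>t. \<Sum>j\<in>neighbours Ea i. kI * a i j / Is $ j * (k_vec \<bullet> \<phi> i j t)) \<longlongrightarrow> c $ i) at_top"
        unfolding c_def vec_lambda_beta
        by (intro tendsto_sum tendsto_mult tendsto_inner tendsto_const \<phi>) (simp add: neighbours_def)
      show "eventually (\<lambda>t. (\<Sum>j\<in>neighbours Ea i. kI * a i j / Is $ j * (k_vec \<bullet> \<phi> i j t)) =
          (if t \<ge> Ta then \<Sum>j\<in>neighbours Ea i. kI * a i j / Is $ j * (k_vec \<bullet> \<phi> i j t) else 0)) at_top"
        using eventually_ge_at_top[of Ta] by eventually_elim simp
    qed
    ultimately show ?thesis unfolding D_def using tendsto_add by fastforce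
  qed
  have "(laplacian E a *v c) $ m = 0" for m
  proof (rule convergent_derivative_limit_0)
    \<comment> \<open>The current is replaced by its expression in \<psi>, which is known to agree
      with it for nonnegative times and can be differentiated termwise.\<close>
    show "((\<lambda>t. (laplacian E a *v ((\<chi> i. Vref) + \<psi> t)) $ m + il $ m) \<longlongrightarrow> I $ m) at_top"
    proof (rule Lim_transform_eventually[OF I[of m]])
      show "eventually (\<lambda>t. it t $ m = (laplacian E a *v ((\<chi> i. Vref) + \<psi> t)) $ m + il $ m) at_top"
        using eventually_ge_at_top[of 0]
        by eventually_elim (use traj in \<open>simp add: microgrid_trajectory_def\<close>)
    qed
    show "((\<lambda>t. \<Sum>n\<in>UNIV. laplacian E a $ m $ n * D n t) \<longlongrightarrow> (laplacian E a *v c) $ m) at_top"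
      unfolding matrix_vector_mult_def vec_lambda_beta by (intro tendsto_intros D_lim)
    fix t :: real assume t: "t > 0"
    have "((\<lambda>s. \<psi> s $ n) has_real_derivative D n t) (at t)" for n
      using attacked_trajectory_derivative[OF traj links, of t n] t at_within_interior[of t "{0..}"]
      by (simp add: D_def interior_real_atLeast)
    then have "((\<lambda>s. (\<Sum>n\<in>UNIV. laplacian E a $ m $ n * (Vref + \<psi> s $ n)) + il $ m) has_real_derivative
        (\<Sum>n\<in>UNIV. laplacian E a $ m $ n * (0 + D n t)) + 0) (at t)"
      by (intro DERIV_add DERIV_sum DERIV_cmult DERIV_const)
    then show "((\<lambda>t. (laplacian E a *v ((\<chi> i. Vref) + \<psi> t)) $ m + il $ m) has_real_derivative
        (\<Sum>n\<in>UNIV. laplacian E a $ m $ n * D n t)) (at t)"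
      by (simp add: matrix_vector_mult_def)
  qed
  then have const: "c $ k = c $ i" for k
    by (intro laplacian_kernel_constant[OF graph]) (simp add: vec_eq_iff)
  \<comment> \<open>Cooperation fixes the constant: equal entries with zero sum vanish.\<close>
  have "(\<Sum>k\<in>UNIV. c $ k) = 0"
    using cooperative by (simp add: c_def sum_links)
  moreover have "(\<Sum>k\<in>UNIV. c $ k) = (\<Sum>k\<in>(UNIV :: 'n set). c $ i)"
    by (intro sum.cong const refl)
  ultimately have "c $ i = 0" by simp
  then show ?thesis by (simp add: c_def)
qed

section \<open>Effect of cooperative attacks on voltage balancing and current sharing\<close>

theorem theorem3:
  fixes E Ea :: "('n::finite \<times> 'n) set"
    and a :: "'n \<Rightarrow> 'n \<Rightarrow> real"
    and Vref kI Ta :: real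
    and Is il :: "real ^ 'n"
    and A :: "'n \<Rightarrow> real ^ 3 ^ 3"
    and Ct :: "'n \<Rightarrow> real"
    and d :: "'n \<Rightarrow> 'n \<Rightarrow> real ^ 2"
    and \<phi> :: "'n \<Rightarrow> 'n \<Rightarrow> real \<Rightarrow> real ^ 3"
    and v it \<psi> v' it' \<psi>' \<psi>\<^sub>a :: "real \<Rightarrow> real ^ 'n"
  assumes graph: "connected_weighted_graph E a"
    and rated: "\<And>i. Is $ i > 0"
    and gain: "kI > 0"
    and closed_loop: "\<And>j. hurwitz (A j)"
    and capacitance: "\<And>j. Ct j > 0"
    and attack_time: "Ta \<ge> 0"
    and attacked_links: "Ea \<subseteq> E"
    and attacks: "\<And>i j. (i, j) \<in> Ea \<Longrightarrow> zts_attack (A j) (E_bar (Ct j)) (d i j) Ta (\<phi> i j)"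
    and attacked_dynamics:
      "microgrid_trajectory E a Vref kI Is il (received_current Ea Ta \<phi> it) v it \<psi>"
    and attack_free_dynamics:
      "microgrid_trajectory E a Vref kI Is il (\<lambda>t i j. it' t $ j) v' it' \<psi>'"
    and same_initial: "\<psi>' 0 = \<psi> 0"
    and balanced_initial: "avg (\<psi> 0) = 0"
    and malicious: "\<And>t. t \<ge> 0 \<Longrightarrow> \<psi> t = \<psi>' t + \<psi>\<^sub>a t"
    and cooperative:
      "(\<Sum>(i, j)\<in>Ea. kI * a i j / Is $ j *
          (k_vec \<bullet> (matrix_inv (A j) *v (E_bar (Ct j) *v d i j)))) = 0"
  shows "((\<lambda>t. avg (\<psi>\<^sub>a t)) \<longlongrightarrow>
           - (\<Sum>(i, j)\<in>Ea. kI * a i j / (real CARD('n) * Is $ j) *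
               (k_vec \<bullet> ((matrix_inv (A j) ** matrix_inv (A j)) *v (E_bar (Ct j) *v d i j)))))
         at_top
       \<and> ((\<Sum>(i, j)\<in>Ea. kI * a i j / Is $ j *
               (k_vec \<bullet> ((matrix_inv (A j) ** matrix_inv (A j)) *v (E_bar (Ct j) *v d i j)))) \<noteq> 0
          \<longrightarrow> \<not> voltage_balancing Vref v)
       \<and> ((\<Sum>(i, j)\<in>Ea. (kI * a i j / Is $ j *
               (k_vec \<bullet> (matrix_inv (A j) *v (E_bar (Ct j) *v d i j)))) *\<^sub>R axis i (1::real))
            \<noteq> (0 :: real ^ 'n)
          \<longrightarrow> \<not> current_sharing Is it)"
proof (intro conjI impI)
  let ?N = "real CARD('n)"
  let ?w = "\<lambda>i j. kI * a i j / Is $ j"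
  let ?e = "\<lambda>i j. E_bar (Ct j) *v d i j"
  define G where "G = (\<lambda>t. \<Sum>(i, j)\<in>Ea. ?w i j * (k_vec \<bullet> (matrix_inv (A j) *v \<phi> i j t)))"
  define X where "X = (\<Sum>(i, j)\<in>Ea. ?w i j * (k_vec \<bullet> ((matrix_inv (A j) ** matrix_inv (A j)) *v ?e i j)))"
  have \<phi>_lim: "(\<phi> i j \<longlongrightarrow> - (matrix_inv (A j) *v ?e i j)) at_top" if "(i, j) \<in> Ea" for i j
    using zts_attack_tendsto[OF closed_loop attacks[OF that]] .
  have avg_\<psi>: "avg (\<psi> t) = G t / ?N" if "t \<ge> Ta" for t
    using sum_control_eq[OF graph attacked_dynamics attacked_links closed_loop attacks cooperative
        attack_time that] balanced_initial
    by (simp add: avg_def G_def)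
  have avg_\<psi>': "avg (\<psi>' t) = 0" if "t \<ge> Ta" for t
  proof -
    \<comment> \<open>The attack-free dynamics are the attacked ones with no attacked link, so the
      same formula for the total applies.\<close>
    have "microgrid_trajectory E a Vref kI Is il (received_current {} Ta \<phi> it') v' it' \<psi>'"
      using attack_free_dynamics by (simp add: received_current_def[abs_def])
    then have "(\<Sum>i\<in>UNIV. \<psi>' t $ i) = (\<Sum>i\<in>UNIV. \<psi>' 0 $ i)"
      using sum_control_eq[OF graph, of Vref kI Is il "{}" Ta \<phi> it' v' \<psi>' A "\<lambda>j. E_bar (Ct j)" d t]
        closed_loop attack_time that by simp
    then show ?thesis using same_initial balanced_initial by (simp add: avg_def)
  qed
  \<comment> \<open>One inverse comes from the antiderivative and one from the limit of \<phi>;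
    together they give the inverse square.\<close>
  have "(G \<longlongrightarrow> (\<Sum>(i, j)\<in>Ea. ?w i j * (k_vec \<bullet> (matrix_inv (A j) *v - (matrix_inv (A j) *v ?e i j))))) at_top"
    unfolding G_def case_prod_beta
    by (intro tendsto_sum tendsto_mult tendsto_const tendsto_inner \<phi>_lim
        bounded_linear.tendsto[OF matrix_vector_mul_bounded_linear]) simp
  also have "(\<Sum>(i, j)\<in>Ea. ?w i j * (k_vec \<bullet> (matrix_inv (A j) *v - (matrix_inv (A j) *v ?e i j)))) = - X"
    by (simp add: X_def linear_neg matrix_vector_mul_assoc matrix_mul_assoc case_prod_beta sum_negf)
  finally have "((\<lambda>t. G t / ?N) \<longlongrightarrow> - X / ?N) at_top" by (intro tendsto_intros) auto
  moreover have "eventually (\<lambda>t. G t / ?N = avg (\<psi> t)) at_top"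
    using eventually_ge_at_top[of Ta] by eventually_elim (simp add: avg_\<psi>)
  ultimately have avg_\<psi>_lim: "((\<lambda>t. avg (\<psi> t)) \<longlongrightarrow> - X / ?N) at_top"
    by (rule Lim_transform_eventually)
  have avg_add: "avg (x + y) = avg x + avg y" for x y :: "real ^ 'n"
    by (simp add: avg_def sum.distrib add_divide_distrib)
  have "((\<lambda>t. avg (\<psi>\<^sub>a t)) \<longlongrightarrow> - X / ?N) at_top"
  proof (rule Lim_transform_eventually[OF avg_\<psi>_lim])
    show "eventually (\<lambda>t. avg (\<psi> t) = avg (\<psi>\<^sub>a t)) at_top"
      using eventually_ge_at_top[of Ta]
      by eventually_elim (use attack_time in \<open>simp add: malicious avg_add avg_\<psi>'\<close>)
  qed
  moreover have "- X / ?N = - (\<Sum>(i, j)\<in>Ea. kI * a i j / (?N * Is $ j) *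
      (k_vec \<bullet> ((matrix_inv (A j) ** matrix_inv (A j)) *v ?e i j)))"
    by (simp add: X_def sum_divide_distrib case_prod_beta mult.commute)
  ultimately show "((\<lambda>t. avg (\<psi>\<^sub>a t)) \<longlongrightarrow> - (\<Sum>(i, j)\<in>Ea. kI * a i j / (?N * Is $ j) *
      (k_vec \<bullet> ((matrix_inv (A j) ** matrix_inv (A j)) *v ?e i j)))) at_top"
    by simp

  show "\<not> voltage_balancing Vref v"
    if "(\<Sum>(i, j)\<in>Ea. ?w i j * (k_vec \<bullet> ((matrix_inv (A j) ** matrix_inv (A j)) *v ?e i j))) \<noteq> 0"
  proof
    assume "voltage_balancing Vref v"
    then have "((\<lambda>t. avg (v t)) \<longlongrightarrow> Vref) at_top" by (simp add: voltage_balancing_def)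
    moreover have "((\<lambda>t. avg (v t)) \<longlongrightarrow> Vref + - X / ?N) at_top"
    proof (rule Lim_transform_eventually)
      show "((\<lambda>t. Vref + avg (\<psi> t)) \<longlongrightarrow> Vref + - X / ?N) at_top"
        by (intro tendsto_add tendsto_const avg_\<psi>_lim)
      have "avg ((\<chi> i. Vref) :: real ^ 'n) = Vref" by (simp add: avg_def)
      moreover have "v t = (\<chi> i. Vref) + \<psi> t" if "t \<ge> 0" for t
        using attacked_dynamics that unfolding microgrid_trajectory_def by blast
      ultimately have "Vref + avg (\<psi> t) = avg (v t)" if "t \<ge> 0" for t
        using that by (simp add: avg_add)
      then show "eventually (\<lambda>t. Vref + avg (\<psi> t) = avg (v t)) at_top"
        using eventually_ge_at_top[of 0] by (rule eventually_mono[rotated])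
    qed
    ultimately have "Vref = Vref + - X / ?N" by (rule tendsto_unique[rotated]) simp
    then have "X = 0" by simp
    with that show False by (simp add: X_def)
  qed

  show "\<not> current_sharing Is it"
    if "(\<Sum>(i, j)\<in>Ea. (?w i j * (k_vec \<bullet> (matrix_inv (A j) *v ?e i j))) *\<^sub>R axis i (1::real)) \<noteq> (0 :: real ^ 'n)"
  proof
    assume "current_sharing Is it"
    moreover have "(\<Sum>(i, j)\<in>Ea. ?w i j * (k_vec \<bullet> - (matrix_inv (A j) *v ?e i j))) = 0"
      using cooperative by (simp add: case_prod_beta sum_negf)
    ultimately have "(\<Sum>j\<in>neighbours Ea i. ?w i j * (k_vec \<bullet> - (matrix_inv (A j) *v ?e i j))) = 0" for i
      using current_sharing_imp_attack_limits_0[OF graph attacked_dynamics attacked_links \<phi>_lim] by blast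
    then have "(\<Sum>j\<in>neighbours Ea i. ?w i j * (k_vec \<bullet> (matrix_inv (A j) *v ?e i j))) = 0" for i
      by (simp add: sum_negf)
    \<comment> \<open>Grouping the links by receiver leaves one multiple of \<open>axis i\<close>
      per DGU, with the vanishing sum over \<open>neighbours Ea i\<close> as coefficient.\<close>
    then have "(\<Sum>(i, j)\<in>Ea. (?w i j * (k_vec \<bullet> (matrix_inv (A j) *v ?e i j))) *\<^sub>R axis i (1::real)) = (0 :: real ^ 'n)"
      unfolding sum_links scaleR_sum_left[symmetric] by simp
    with that show False by contradiction
  qed
qed

end
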